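(* Let $D$ be an oriented diagram of a knot. Then $$s(D) \leq U(D),$$ where $s(D)$ denotes the Rasmussen invariant of the knot represented by $D$.
   Context: Rasmussen invariant: for a diagram $D$ of a knot $K$, consider Lee's filtered chain complex $\mathscr{F}^jC^i(D)$ with complex coefficients, i.e. the perturbed Khovanov complex built from the Frobenius algebra $\mathbb{C}\hookrightarrow \mathbb{C}[x]/(x^2-1)$, where $i$ is the homological grading and $\cdots\subseteq\mathscr{F}^{j+1}C^i\subseteq\mathscr{F}^jC^i\subseteq\cdots$ is the quantum filtration. Its homology is 2-dimensional, supported in $i=0$, and generated by Lee's canonical classes $[\mathfrak{s}_o],[\mathfrak{s}_{\bar o}]$ associated with the orientation $o$ of $D$ and the reverse orientation. Let $s_{\min}(D)$ be the largest $j$ such that $[\mathfrak{s}_o]$ (equivalently $[\mathfrak{s}_{\bar o}]$) lies in $\mathscr{F}^jH^0(D)$. Then $s(D)=s(K)=s_{\min}(D)+1\in 2\mathbb{Z}$. This depends only on $K$, and with this normalization $s(K)=2g^*(K)$ for positive knots, where $g^*$ is the smooth slice genus. Seifert graph: let $O(D)$ be the oriented resolution of $D$ (every crossing is smoothed respecting orientation), a disjoint union of circles. The Seifert graph $T(D)$ has one node for each circle of $O(D)$ and, for each positive (respectively negative) crossing of $D$, one edge decorated with $+$ (respectively $-$) joining the two distinct circles on which the smoothed crossing lies. The subgraph $T^-(D)$ (respectively $T^+(D)$) is obtained from $T(D)$ by removing all edges decorated with $+$ (respectively $-$), keeping all nodes. Let $w(D)$ be the writhe of $D$ (number of positive crossings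 minus number of negative crossings). Define $$U(D)=\#\mathrm{nodes}(T(D))-2\,\#\mathrm{components}(T^-(D))+w(D)+1 .$$ *)

theory Defs
  imports Complex_Main
begin

definition classes :: "'a set \<Rightarrow> 'a rel \<Rightarrow> 'a set set" where
  "classes A r = A // {(x, y). equivclp (\<lambda>u v. (u, v) \<in> r) x y}"


section \<open>Oriented knot diagrams\<close>

text \<open>
  Diagrams are encoded combinatorially. The arcs are the oriented edges of the underlying
  4-valent plane graph; an arc that meets no crossing is a circle without crossings.
  Each crossing is rotated so that both of its strands run upwards:

    out_l   out_r
        \ /
         X
        / \
    in_l    in_r

  The two strands are in_l to out_r and in_r to out_l. The crossing is positive iff the
  strand from in_l to out_r is the upper one.
\<close>

record 'a crossing =
  positive :: bool
  in_l :: 'a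
  in_r :: 'a
  out_l :: 'a
  out_r :: 'a

datatype side = Lft | Rgt

fun opposite :: "side \<Rightarrow> side" where
  "opposite Lft = Rgt"
| "opposite Rgt = Lft"

text \<open>
  The pair \<open>(a, Lft)\<close> stands for the region of the plane immediately to the left of the
  arc \<open>a\<close> with respect to its orientation. The field \<open>outer\<close> names a side of an arc
  that faces the unbounded region. The order of the list of crossings only serves to fix the
  signs in the cube of resolutions.
\<close>

record 'a diagram =
  arcs :: "'a set"
  crossings :: "'a crossing list"
  outer :: "'a \<times> side"

abbreviation ncross :: "'a diagram \<Rightarrow> nat" where
  "ncross D \<equiv> length (crossings D)"

definition pos_crossings :: "'a diagram \<Rightarrow> nat set" where
  "pos_crossings D = {c. c < ncross D \<and> positive (crossings D ! c)}"

definition neg_crossings :: "'a diagram \<Rightarrow> nat set" where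
  "neg_crossings D = {c. c < ncross D \<and> \<not> positive (crossings D ! c)}"

definition writhe :: "'a diagram \<Rightarrow> int" where
  "writhe D = int (card (pos_crossings D)) - int (card (neg_crossings D))"

definition strands :: "'a crossing \<Rightarrow> 'a rel" where
  "strands x = {(in_l x, out_r x), (in_r x, out_l x)}"

text \<open>The four corners of a crossing (east, north, west, south), each identifying the two
  sides of arcs that bound it.\<close>

definition corners :: "'a crossing \<Rightarrow> ('a \<times> side) rel" where
  "corners x =
    {((in_r x, Rgt), (out_r x, Rgt)),
     ((out_r x, Lft), (out_l x, Rgt)),
     ((out_l x, Lft), (in_l x, Lft)),
     ((in_l x, Rgt), (in_r x, Lft))}"

definition regions :: "'a diagram \<Rightarrow> ('a \<times> side) set set" where
  "regions D = classes (arcs D \<times> UNIV) (\<Union>x\<in>set (crossings D). corners x)"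

text \<open>
  Every arc either leaves exactly one crossing end and enters exactly one crossing end, or
  meets no crossing.  The diagram has a single component, and it lies in the plane: for a
  connected diagram with \<open>n\<close> crossings the surface obtained by gluing a disc into each
  region is a sphere iff there are \<open>n + 2\<close> regions, by Euler's formula with \<open>n\<close> vertices
  and \<open>2 n\<close> edges. The same count is right for the circle without crossings.
\<close>

definition knot_diagram :: "'a diagram \<Rightarrow> bool" where
  "knot_diagram D \<longleftrightarrow>
     finite (arcs D) \<and>
     (let ins = concat (map (\<lambda>x. [in_l x, in_r x]) (crossings D));
          outs = concat (map (\<lambda>x. [out_l x, out_r x]) (crossings D))
      in distinct ins \<and> distinct outs \<and> set ins = set outs \<and> set ins \<subseteq> arcs D) \<and>
     fst (outer D) \<in> arcs D \<and>
     (\<forall>a\<in>arcs D. \<forall>b\<in>arcs D. (a, b) \<in> (\<Union>x\<in>set (crossings D). strands x)\<^sup>*) \<and>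
     card (regions D) = ncross D + 2"


section \<open>The cube of resolutions\<close>

definition oriented_smoothing :: "'a crossing \<Rightarrow> 'a rel" where
  "oriented_smoothing x = {(in_l x, out_l x), (in_r x, out_r x)}"

definition unoriented_smoothing :: "'a crossing \<Rightarrow> 'a rel" where
  "unoriented_smoothing x = {(in_l x, in_r x), (out_l x, out_r x)}"

definition smoothing0 :: "'a crossing \<Rightarrow> 'a rel" where
  "smoothing0 x = (if positive x then oriented_smoothing x else unoriented_smoothing x)"

definition smoothing1 :: "'a crossing \<Rightarrow> 'a rel" where
  "smoothing1 x = (if positive x then unoriented_smoothing x else oriented_smoothing x)"

text \<open>A vertex of the cube is given by the set \<open>v\<close> of indices of the crossings that are
  1-smoothed; a circle is the set of arcs on it.\<close>

definition circles :: "'a diagram \<Rightarrow> nat set \<Rightarrow> 'a set set" where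
  "circles D v = classes (arcs D)
     (\<Union>c<ncross D. if c \<in> v then smoothing1 (crossings D ! c) else smoothing0 (crossings D ! c))"

definition oriented_resolution :: "'a diagram \<Rightarrow> nat set" where
  "oriented_resolution D = neg_crossings D"


section \<open>Lee's filtered complex\<close>

text \<open>
  The pair \<open>(v, X)\<close> with \<open>X \<subseteq> circles D v\<close> is the basis element of the tensor product
  of copies of \<open>\<complex>[x]/(x\<^sup>2 - 1)\<close>, one for each circle, that has the factor \<open>x\<close> at the
  circles in \<open>X\<close> and the factor \<open>1\<close> at all others. Chains are coefficient functions.
\<close>

type_synonym 'a enhanced = "nat set \<times> 'a set set"
type_synonym 'a chain = "'a enhanced \<Rightarrow> complex"

definition enhanced_states :: "'a diagram \<Rightarrow> 'a enhanced set" where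
  "enhanced_states D = {(v, X). v \<subseteq> {..<ncross D} \<and> X \<subseteq> circles D v}"

fun hdeg :: "'a diagram \<Rightarrow> 'a enhanced \<Rightarrow> int" where
  "hdeg D (v, X) = int (card v) - int (card (neg_crossings D))"

fun qdeg :: "'a diagram \<Rightarrow> 'a enhanced \<Rightarrow> int" where
  "qdeg D (v, X) = int (card (circles D v - X)) - int (card X) + int (card v)
     + int (card (pos_crossings D)) - 2 * int (card (neg_crossings D))"

definition chains :: "'a diagram \<Rightarrow> int \<Rightarrow> 'a chain set" where
  "chains D i = {f. \<forall>e. f e \<noteq> 0 \<longrightarrow> e \<in> enhanced_states D \<and> hdeg D e = i}"

definition filtered_chains :: "'a diagram \<Rightarrow> int \<Rightarrow> int \<Rightarrow> 'a chain set" where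
  "filtered_chains D j i = {f \<in> chains D i. \<forall>e. f e \<noteq> 0 \<longrightarrow> qdeg D e \<ge> j}"

text \<open>
  Structure constants of the Frobenius algebra. By (co)commutativity it suffices to record
  how many factors of a basis tensor are \<open>x\<close>: the multiplication is
  \<open>1 \<cdot> 1 = 1\<close>, \<open>1 \<cdot> x = x \<cdot> 1 = x\<close>, \<open>x \<cdot> x = 1\<close>,
  and the comultiplication is
  \<open>1 \<mapsto> 1 \<otimes> x + x \<otimes> 1\<close>, \<open>x \<mapsto> x \<otimes> x + 1 \<otimes> 1\<close>.
\<close>

definition mult_coeff :: "nat \<Rightarrow> nat \<Rightarrow> complex" where
  "mult_coeff p q = (if (p, q) \<in> {(0, 0), (1, 1), (2, 0)} then 1 else 0)"

definition comult_coeff :: "nat \<Rightarrow> nat \<Rightarrow> complex" where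
  "comult_coeff p q = (if (p, q) \<in> {(0, 1), (1, 0), (1, 2)} then 1 else 0)"

text \<open>
  The matrix entry, from \<open>(v, X)\<close> to \<open>(w, Y)\<close>, of the unsigned map along an edge from \<open>v\<close>
  to \<open>w\<close> of the cube: the identity on the circles common to both ends, and the
  multiplication or comultiplication according as two circles merge or one circle splits.
\<close>

definition edge_coeff ::
  "'a diagram \<Rightarrow> 'a enhanced \<Rightarrow> 'a enhanced \<Rightarrow> complex" where
  "edge_coeff D = (\<lambda>(v, X) (w, Y).
     let old = circles D v - circles D w; new = circles D w - circles D v;
         p = card (X \<inter> old); q = card (Y \<inter> new)
     in if X - old \<noteq> Y - new then 0
        else if card old = 2 \<and> card new = 1 then mult_coeff p q
        else if card old = 1 \<and> card new = 2 then comult_coeff p q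
        else 0)"

definition lee_d :: "'a diagram \<Rightarrow> 'a chain \<Rightarrow> 'a chain" where
  "lee_d D f = (\<lambda>(w, Y).
     if (w, Y) \<in> enhanced_states D then
       \<Sum>c\<in>w. \<Sum>X\<in>Pow (circles D (w - {c})).
         (-1) ^ card {b \<in> w. b < c} * edge_coeff D (w - {c}, X) (w, Y) * f (w - {c}, X)
     else 0)"

definition cycles :: "'a diagram \<Rightarrow> int \<Rightarrow> 'a chain set" where
  "cycles D i = {f \<in> chains D i. lee_d D f = (\<lambda>_. 0)}"

definition homology_class :: "'a diagram \<Rightarrow> int \<Rightarrow> 'a chain \<Rightarrow> 'a chain set" where
  "homology_class D i z = {(\<lambda>e. z e + lee_d D g e) | g. g \<in> chains D (i - 1)}"

definition filtered_homology :: "'a diagram \<Rightarrow> int \<Rightarrow> int \<Rightarrow> 'a chain set set" where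
  "filtered_homology D j i = homology_class D i ` (cycles D i \<inter> filtered_chains D j i)"


section \<open>Lee's canonical class and the Rasmussen invariant\<close>

text \<open>\<open>joined_to_outer D s k\<close>: a generic path that crosses the diagram in \<open>k\<close> points
  leads from the unbounded region to the side \<open>s\<close>.\<close>

inductive joined_to_outer :: "'a diagram \<Rightarrow> 'a \<times> side \<Rightarrow> nat \<Rightarrow> bool" for D where
  start: "joined_to_outer D (outer D) 0"
| within: "joined_to_outer D s k \<Longrightarrow> x \<in> set (crossings D) \<Longrightarrow>
    (s, t) \<in> corners x \<or> (t, s) \<in> corners x \<Longrightarrow> joined_to_outer D t k"
| across: "joined_to_outer D (a, b) k \<Longrightarrow> joined_to_outer D (a, opposite b) (Suc k)"

text \<open>
  The circle \<open>C\<close> of the oriented resolution carries the label \<open>x + 1\<close> or \<open>x - 1\<close>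
  according as the number of circles separating it from infinity, plus one if it is oriented
  counterclockwise, is even or odd. This is the parity of the number of circles separating
  the region on the left of \<open>C\<close> from infinity, and replacing the diagram by its oriented
  resolution does not change the parity of the number of crossings with a path.
\<close>

definition odd_circle :: "'a diagram \<Rightarrow> 'a set \<Rightarrow> bool" where
  "odd_circle D C \<longleftrightarrow> (\<exists>a\<in>C. \<exists>k. joined_to_outer D (a, Lft) k \<and> odd k)"

definition canonical_generator :: "'a diagram \<Rightarrow> 'a chain" where
  "canonical_generator D = (\<lambda>(v, X).
     if v = oriented_resolution D \<and> X \<subseteq> circles D v
     then \<Prod>C\<in>circles D v - X. (if odd_circle D C then -1 else 1)
     else 0)"

definition s_min :: "'a diagram \<Rightarrow> int" where
  "s_min D = (GREATEST j. homology_class D 0 (canonical_generator D) \<in> filtered_homology D j 0)"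

definition rasmussen_s :: "'a diagram \<Rightarrow> int" where
  "rasmussen_s D = s_min D + 1"


section \<open>The Seifert graph\<close>

record ('n, 'e) signed_graph =
  nodes :: "'n set"
  edges :: "'e set"
  ends :: "'e \<Rightarrow> 'n set"
  plus :: "'e \<Rightarrow> bool"

definition components :: "('n, 'e) signed_graph \<Rightarrow> 'n set set" where
  "components G = classes (nodes G) {(A, B). \<exists>e\<in>edges G. ends G e = {A, B}}"

definition minus_subgraph :: "('n, 'e) signed_graph \<Rightarrow> ('n, 'e) signed_graph" where
  "minus_subgraph G = G\<lparr>edges := {e \<in> edges G. \<not> plus G e}\<rparr>"

definition seifert_graph :: "'a diagram \<Rightarrow> ('a set, nat) signed_graph" where
  "seifert_graph D =
     \<lparr>nodes = circles D (oriented_resolution D),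
      edges = {..<ncross D},
      ends = (\<lambda>c. {C \<in> circles D (oriented_resolution D).
                   in_l (crossings D ! c) \<in> C \<or> in_r (crossings D ! c) \<in> C}),
      plus = (\<lambda>c. positive (crossings D ! c))\<rparr>"

definition U_bound :: "'a diagram \<Rightarrow> int" where
  "U_bound D = int (card (nodes (seifert_graph D)))
         - 2 * int (card (components (minus_subgraph (seifert_graph D)))) + writhe D + 1"

end

theory Submission
  imports Defs
begin

text \<open>
  All edges of the cube that end at the oriented resolution come from negative crossings, and the
  two circles at such a crossing are distinct with opposite labels, because the diagram has a
  checkerboard colouring. Hence a linear functional on the chains over the oriented resolution
  vanishes on boundaries as soon as it is compatible with \<open>x\<^sub>A = - x\<^sub>B\<close> for the edges \<open>{A, B}\<close> of
  \<open>T\<^sup>-(D)\<close>. The signed sum of the coefficients of those basis tensors that have an odd number of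
  factors \<open>x\<close> in each component of \<open>T\<^sup>-(D)\<close> is such a functional, and it does not vanish on the
  canonical generator. So every representative of the canonical class involves a basis tensor with
  at least as many factors \<open>x\<close> as \<open>T\<^sup>-(D)\<close> has components, which bounds its quantum degree.
\<close>


section \<open>Classes of a generated equivalence\<close>

lemma classes_eq_image: "classes A r = (\<lambda>x. {y. equivclp (\<lambda>u v. (u, v) \<in> r) x y}) ` A"
  by (auto simp: classes_def quotient_def)

lemma classes_coverE:
  assumes "x \<in> A"
  obtains C where "C \<in> classes A r" "x \<in> C"
proof
  show "{y. equivclp (\<lambda>u v. (u, v) \<in> r) x y} \<in> classes A r"
    unfolding classes_eq_image using assms by (rule imageI)
  show "x \<in> {y. equivclp (\<lambda>u v. (u, v) \<in> r) x y}" by simp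
qed

lemma classes_nonempty:
  assumes "C \<in> classes A r"
  obtains x where "x \<in> A" "x \<in> C"
  using assms by (auto simp: classes_eq_image)

lemma classes_eq_Collect:
  assumes "C \<in> classes A r" "x \<in> C"
  shows "C = {y. equivclp (\<lambda>u v. (u, v) \<in> r) x y}"
proof -
  obtain z where C: "C = {y. equivclp (\<lambda>u v. (u, v) \<in> r) z y}"
    using assms(1) unfolding classes_eq_image by blast
  with assms(2) have zx: "equivclp (\<lambda>u v. (u, v) \<in> r) z x" by simp
  show ?thesis unfolding C
    using equivclp_trans[OF zx] equivclp_trans[OF equivclp_sym[OF zx]] by blast
qed

lemma classes_unique:
  assumes "C \<in> classes A r" "C' \<in> classes A r" "x \<in> C" "x \<in> C'"
  shows "C = C'"
  using assms classes_eq_Collect by metis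

lemma classes_closed:
  assumes "C \<in> classes A r" "(x, y) \<in> r"
  shows "x \<in> C \<longleftrightarrow> y \<in> C"
proof -
  have "equivclp (\<lambda>u v. (u, v) \<in> r) x y"
    using assms(2) by (simp add: r_into_equivclp)
  then have "equivclp (\<lambda>u v. (u, v) \<in> r) y x" by (rule equivclp_sym)
  have "y \<in> C" if "x \<in> C"
    unfolding classes_eq_Collect[OF assms(1) that] by (rule CollectI) fact
  moreover have "x \<in> C" if "y \<in> C"
    unfolding classes_eq_Collect[OF assms(1) that] by (rule CollectI) fact
  ultimately show ?thesis by blast
qed

lemma classes_invariant:
  assumes "C \<in> classes A r" "x \<in> C" "y \<in> C" "\<And>u v. (u, v) \<in> r \<Longrightarrow> f u = f v"
  shows "f x = f y"
proof -
  have "f u = f v" if "equivclp (\<lambda>u v. (u, v) \<in> r) u v" for u v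
    using that by (induction rule: equivclp_induct) (auto dest: assms(4))
  moreover have "equivclp (\<lambda>u v. (u, v) \<in> r) x y"
    using assms(3) classes_eq_Collect[OF assms(1,2)] by blast
  ultimately show ?thesis by blast
qed

lemma classes_subset:
  assumes "C \<in> classes A r" "r \<subseteq> A \<times> A"
  shows "C \<subseteq> A"
proof
  fix y assume "y \<in> C"
  obtain x where "x \<in> A" "x \<in> C" using assms(1) by (rule classes_nonempty)
  with \<open>y \<in> C\<close> show "y \<in> A"
    using classes_invariant[OF assms(1), of x y "\<lambda>z. z \<in> A"] assms(2) by auto
qed

lemma finite_classes: "finite A \<Longrightarrow> finite (classes A r)"
  by (simp add: classes_eq_image)

text \<open>Elements of \<open>C\<close> are linked by pairs of \<open>r\<close> alone, and no pair
  of \<open>t\<close> touches \<open>C\<close>, so trading \<open>s\<close> for \<open>t\<close>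
  keeps the class. This applies to circles that avoid the crossing whose smoothing changes.\<close>

lemma classes_change_off:
  assumes C: "C \<in> classes A (r \<union> s)" and s: "C \<inter> Field s = {}" and t: "C \<inter> Field t = {}"
  shows "C \<in> classes A (r \<union> t)"
proof -
  obtain x where x: "x \<in> A" "x \<in> C" using C by (rule classes_nonempty)
  obtain B where B: "B \<in> classes A (r \<union> t)" "x \<in> B" using x(1) by (rule classes_coverE)
  have "B \<subseteq> C"
  proof
    fix y assume "y \<in> B"
    have "u \<in> C \<longleftrightarrow> v \<in> C" if "(u, v) \<in> r \<union> t" for u v
      using that classes_closed[OF C, of u v] t by (auto simp: Field_def)
    with classes_invariant[OF B(1) B(2) \<open>y \<in> B\<close>, of "\<lambda>z. z \<in> C"] x(2) show "y \<in> C" by blast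
  qed
  moreover have "C \<subseteq> B"
  proof
    fix y assume "y \<in> C"
    have "u \<in> B \<longleftrightarrow> v \<in> B" if "(u, v) \<in> r \<union> s" for u v
      using that classes_closed[OF B(1), of u v] \<open>B \<subseteq> C\<close> s by (auto simp: Field_def)
    with classes_invariant[OF C x(2) \<open>y \<in> C\<close>, of "\<lambda>z. z \<in> B"] B(2) show "y \<in> B" by blast
  qed
  ultimately show ?thesis using B(1) by simp
qed

lemma card_classes_le:
  assumes "finite X" "\<And>K. K \<in> classes A r \<Longrightarrow> X \<inter> K \<noteq> {}"
  shows "card (classes A r) \<le> card X"
proof -
  define g where "g x = {y. equivclp (\<lambda>u v. (u, v) \<in> r) x y}" for x
  have "classes A r \<subseteq> g ` X"
  proof
    fix K assume K: "K \<in> classes A r"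
    obtain x where x: "x \<in> X" "x \<in> K" using assms(2)[OF K] by blast
    have "K = g x" unfolding g_def by (rule classes_eq_Collect[OF K x(2)])
    with x(1) show "K \<in> g ` X" by blast
  qed
  then show ?thesis using assms(1) by (metis card_image_le card_mono finite_imageI le_trans)
qed

text \<open>Applied to the components of the minus subgraph, this yields a basis tensor with exactly
  one factor \<open>x\<close> in each component, which makes the detecting functional
  nonzero.\<close>

lemma classes_transversal:
  assumes "r \<subseteq> A \<times> A"
  obtains X where "X \<subseteq> A" "\<And>K. K \<in> classes A r \<Longrightarrow> card (X \<inter> K) = 1"
proof -
  define c where "c K = (SOME x. x \<in> K)" for K :: "'a set"
  have c: "c K \<in> K" if "K \<in> classes A r" for K
    unfolding c_def using classes_nonempty[OF that] by (metis someI)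
  show thesis
  proof
    show "c ` classes A r \<subseteq> A"
      using c classes_subset[OF _ assms] by blast
    show "card (c ` classes A r \<inter> K) = 1" if K: "K \<in> classes A r" for K
    proof -
      have "c ` classes A r \<inter> K = {c K}"
        using c K by (auto dest: classes_unique[OF K, of _ "c _"])
      then show ?thesis by simp
    qed
  qed
qed


section \<open>The checkerboard colouring\<close>

lemma distinct_concat_pairs:
  assumes "distinct (concat (map (\<lambda>x. [f x, g x]) xs))" "i < length xs" "j < length xs"
  shows "f (xs ! i) \<noteq> g (xs ! j)" "f (xs ! i) = f (xs ! j) \<longleftrightarrow> i = j"
    "g (xs ! i) = g (xs ! j) \<longleftrightarrow> i = j"
proof -
  have "f (xs ! i) \<noteq> g (xs ! j) \<and> (f (xs ! i) = f (xs ! j) \<longleftrightarrow> i = j) \<and>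
    (g (xs ! i) = g (xs ! j) \<longleftrightarrow> i = j)"
    using assms
  proof (induction xs arbitrary: i j)
    case (Cons x xs)
    have "f x \<noteq> g x" "\<And>k. k < length xs \<Longrightarrow> f x \<noteq> f (xs ! k) \<and> f x \<noteq> g (xs ! k) \<and>
        g x \<noteq> f (xs ! k) \<and> g x \<noteq> g (xs ! k)"
      using Cons.prems(1) by (auto simp: all_set_conv_all_nth)
    note new = this
    show ?case
    proof (cases i; cases j)
      fix i' j' assume ij: "i = Suc i'" "j = Suc j'"
      have "distinct (concat (map (\<lambda>x. [f x, g x]) xs))" "i' < length xs" "j' < length xs"
        using Cons.prems ij by simp_all
      from Cons.IH[OF this] show ?thesis using ij by simp
    next
      fix j' assume "i = 0" "j = Suc j'"
      with new(2)[of j'] Cons.prems(3) show ?thesis by simp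
    next
      fix i' assume "i = Suc i'" "j = 0"
      with new(2)[of i'] Cons.prems(2) show ?thesis by (simp del: distinct.simps, metis)
    qed (use new(1) in simp)
  qed simp
  then show "f (xs ! i) \<noteq> g (xs ! j)" "f (xs ! i) = f (xs ! j) \<longleftrightarrow> i = j"
    "g (xs ! i) = g (xs ! j) \<longleftrightarrow> i = j" by auto
qed

section \<open>Ends and sides of the arcs of a knot diagram\<close>

locale knot =
  fixes D :: "'a diagram"
  assumes knot: "knot_diagram D"
begin

abbreviation cr :: "nat \<Rightarrow> 'a crossing" where "cr c \<equiv> crossings D ! c"

abbreviation v0 :: "nat set" where "v0 \<equiv> oriented_resolution D"

lemma finite_arcs: "finite (arcs D)"
  using knot by (simp add: knot_diagram_def)

lemma outer_arc: "fst (outer D) \<in> arcs D"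
  using knot by (simp add: knot_diagram_def Let_def)

lemma card_regions: "card (regions D) = ncross D + 2"
  using knot by (simp add: knot_diagram_def Let_def)

lemma strands_connected:
  "a \<in> arcs D \<Longrightarrow> b \<in> arcs D \<Longrightarrow> (a, b) \<in> (\<Union>x\<in>set (crossings D). strands x)\<^sup>*"
  using knot by (simp add: knot_diagram_def Let_def)

lemma distinct_ends:
  "distinct (concat (map (\<lambda>x. [in_l x, in_r x]) (crossings D)))"
  "distinct (concat (map (\<lambda>x. [out_l x, out_r x]) (crossings D)))"
  using knot unfolding knot_diagram_def Let_def by blast+

lemma set_ends:
  "set (concat (map (\<lambda>x. [in_l x, in_r x]) (crossings D))) =
   set (concat (map (\<lambda>x. [out_l x, out_r x]) (crossings D)))"
  "set (concat (map (\<lambda>x. [in_l x, in_r x]) (crossings D))) \<subseteq> arcs D"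
  using knot unfolding knot_diagram_def Let_def by blast+

lemma end_arcs:
  assumes "x \<in> set (crossings D)"
  shows "in_l x \<in> arcs D" "in_r x \<in> arcs D" "out_l x \<in> arcs D" "out_r x \<in> arcs D"
proof -
  have "{in_l x, in_r x} \<subseteq> set (concat (map (\<lambda>x. [in_l x, in_r x]) (crossings D)))"
    "{out_l x, out_r x} \<subseteq> set (concat (map (\<lambda>x. [out_l x, out_r x]) (crossings D)))"
    using assms by auto
  with set_ends show "in_l x \<in> arcs D" "in_r x \<in> arcs D" "out_l x \<in> arcs D" "out_r x \<in> arcs D"
    by blast+
qed

lemma corners_arcs: "x \<in> set (crossings D) \<Longrightarrow> corners x \<subseteq> (arcs D \<times> UNIV) \<times> (arcs D \<times> UNIV)"
  using end_arcs by (auto simp: corners_def)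

text \<open>A strand path that starts at an incoming end is trivial or stops at an outgoing end, and
  outgoing ends are also incoming ends. So a diagram with crossings has no arc that avoids
  them.\<close>

lemma arcs_eq_ins:
  assumes "crossings D \<noteq> []"
  shows "arcs D = set (concat (map (\<lambda>x. [in_l x, in_r x]) (crossings D)))" (is "_ = ?I")
proof
  show "?I \<subseteq> arcs D" by (rule set_ends)
  show "arcs D \<subseteq> ?I"
  proof
    fix b assume b: "b \<in> arcs D"
    define x where "x = hd (crossings D)"
    have x: "x \<in> set (crossings D)" using assms by (simp add: x_def)
    have "(in_l x, b) \<in> (\<Union>x\<in>set (crossings D). strands x)\<^sup>*"
      by (rule strands_connected[OF end_arcs(1)[OF x] b])
    then show "b \<in> ?I"
    proof cases
      case base
      with x show ?thesis by auto
    next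
      case (step y)
      then have "b \<in> set (concat (map (\<lambda>x. [out_l x, out_r x]) (crossings D)))"
        by (auto simp: strands_def)
      with set_ends(1) show ?thesis by simp
    qed
  qed
qed

lemma card_arcs:
  assumes "crossings D \<noteq> []"
  shows "card (arcs D) = 2 * ncross D"
proof -
  have "length (concat (map (\<lambda>x. [in_l x, in_r x]) xs)) = 2 * length xs" for xs :: "'a crossing list"
    by (induction xs) auto
  then show ?thesis
    using distinct_card[OF distinct_ends(1)] arcs_eq_ins[OF assms] by simp
qed

text \<open>A property invariant under turning at corners and stepping across arcs is transported
  along strands, and the strands connect all arcs of a knot.\<close>

lemma sides_connected:
  assumes corner: "\<And>x s t. x \<in> set (crossings D) \<Longrightarrow> (s, t) \<in> corners x \<Longrightarrow> P s \<longleftrightarrow> P t"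
    and across: "\<And>a. a \<in> arcs D \<Longrightarrow> P (a, Lft) \<longleftrightarrow> P (a, Rgt)"
    and "fst s \<in> arcs D" "fst t \<in> arcs D"
  shows "P s \<longleftrightarrow> P t"
proof -
  have "P (a, Lft) \<longleftrightarrow> P (b, Lft)" if "(a, b) \<in> (\<Union>x\<in>set (crossings D). strands x)\<^sup>*" for a b
    using that
  proof induction
    case (step b c)
    then obtain x where x: "x \<in> set (crossings D)" "(b, c) \<in> strands x" by blast
    \<comment> \<open>The strand from \<open>in_l\<close> to \<open>out_r\<close> is followed
      through the south corner, across \<open>in_r\<close> and through the east corner; the other
      one through the south corner, across \<open>in_l\<close> and through the west corner.\<close>
    have "P (in_r x, Rgt) \<longleftrightarrow> P (out_r x, Rgt)" "P (out_l x, Lft) \<longleftrightarrow> P (in_l x, Lft)"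
      "P (in_l x, Rgt) \<longleftrightarrow> P (in_r x, Lft)"
      by (rule corner[OF x(1)]; simp add: corners_def)+
    with across end_arcs[OF x(1)] x(2) step.IH show ?case
      by (auto simp: strands_def)
  qed simp
  from this[OF strands_connected[OF assms(3,4)]] show ?thesis
    using across[OF assms(3)] across[OF assms(4)]
    by (cases s; cases t; cases "snd s"; cases "snd t") simp_all
qed

section \<open>Cycles modulo 2 in the graph of crossings and arcs\<close>

definition bd :: "'a set \<Rightarrow> nat set" where
  "bd A = {c \<in> {..<ncross D}. ((in_l (cr c) \<in> A) \<noteq> (in_r (cr c) \<in> A)) \<noteq>
     ((out_l (cr c) \<in> A) \<noteq> (out_r (cr c) \<in> A))}"

lemma bd_sym_diff: "bd (sym_diff A B) = sym_diff (bd A) (bd B)"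
proof (rule set_eqI)
  have mem: "x \<in> sym_diff P Q \<longleftrightarrow> (x \<in> P) \<noteq> (x \<in> Q)" for x :: 'b and P Q by blast
  show "c \<in> bd (sym_diff A B) \<longleftrightarrow> c \<in> sym_diff (bd A) (bd B)" for c
    unfolding mem bd_def mem_Collect_eq by argo
qed

text \<open>Every arc leaves one crossing and enters one crossing. The ends are counted modulo 2, so
  a loop, with \<open>i = j\<close>, has empty boundary.\<close>

lemma bd_single:
  assumes "i < ncross D" "j < ncross D" "a = out_l (cr i) \<or> a = out_r (cr i)"
    "a = in_l (cr j) \<or> a = in_r (cr j)"
  shows "bd {a} = sym_diff {i} {j}"
proof (rule set_eqI)
  fix k
  show "k \<in> bd {a} \<longleftrightarrow> k \<in> sym_diff {i} {j}"
  proof (cases "k < ncross D")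
    case True
    note d1 = distinct_concat_pairs[OF distinct_ends(1)] and d2 = distinct_concat_pairs[OF distinct_ends(2)]
    have "((in_l (cr k) = a) \<noteq> (in_r (cr k) = a)) \<longleftrightarrow> k = j"
      using assms(4) d1[OF True assms(2)] d1[OF assms(2) True] by metis
    moreover have "((out_l (cr k) = a) \<noteq> (out_r (cr k) = a)) \<longleftrightarrow> k = i"
      using assms(3) d2[OF True assms(1)] d2[OF assms(1) True] by metis
    ultimately show ?thesis using True by (simp add: bd_def) blast
  qed (use assms in \<open>auto simp: bd_def\<close>)
qed

text \<open>The arcs on a strand path, added modulo 2, have the two end crossings as boundary. The
  induction runs along the path, with \<open>j\<close> the crossing that the current arc
  enters.\<close>

lemma bd_pair:
  assumes "i < ncross D" "j < ncross D"
  shows "\<exists>A \<subseteq> arcs D. bd A = sym_diff {i} {j}"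
proof -
  have "\<forall>j<ncross D. b = in_l (cr j) \<or> b = in_r (cr j) \<longrightarrow>
      (\<exists>A \<subseteq> arcs D. bd A = sym_diff {i} {j})"
    if "(in_l (cr i), b) \<in> (\<Union>x\<in>set (crossings D). strands x)\<^sup>*" for b
    using that
  proof induction
    case base
    have "bd {} = {}" by (simp add: bd_def)
    with assms(1) show ?case
      using distinct_concat_pairs[OF distinct_ends(1)] by (metis Diff_cancel empty_subsetI sup.idem)
  next
    case (step b c)
    then obtain k where k: "k < ncross D" "(b, c) \<in> strands (cr k)"
      by (auto simp: in_set_conv_nth)
    have b: "b = in_l (cr k) \<or> b = in_r (cr k)" and c: "c = out_l (cr k) \<or> c = out_r (cr k)"
      using k(2) by (auto simp: strands_def)
    obtain A where A: "A \<subseteq> arcs D" "bd A = sym_diff {i} {k}"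
      using step.IH k(1) b by blast
    have "c \<in> arcs D" using c end_arcs[of "cr k"] k(1) by auto
    show ?case
    proof (intro allI impI)
      fix j assume j: "j < ncross D" "c = in_l (cr j) \<or> c = in_r (cr j)"
      have "bd (sym_diff A {c}) = sym_diff {i} {j}"
        unfolding bd_sym_diff A(2) bd_single[OF k(1) j(1) c j(2)] by blast
      moreover have "sym_diff A {c} \<subseteq> arcs D" using A(1) \<open>c \<in> arcs D\<close> by blast
      ultimately show "\<exists>A \<subseteq> arcs D. bd A = sym_diff {i} {j}" by blast
    qed
  qed
  moreover have "(in_l (cr i), in_l (cr j)) \<in> (\<Union>x\<in>set (crossings D). strands x)\<^sup>*"
    using strands_connected assms end_arcs(1) by simp
  ultimately show ?thesis using assms(2) by blast
qed

text \<open>Crossing 0 serves as base point: the boundaries {0, c} of \<open>bd_pair\<close> add up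
  to any set of crossings away from 0.\<close>

lemma bd_onto:
  assumes "V \<subseteq> {..<ncross D} - {0}"
  shows "\<exists>A \<subseteq> arcs D. bd A - {0} = V"
proof -
  have "finite V" using assms finite_subset by blast
  then show ?thesis using assms
  proof (induction V)
    case empty
    have "bd {} = {}" by (simp add: bd_def)
    then show ?case by (metis empty_Diff empty_subsetI)
  next
    case (insert c V)
    then obtain A where A: "A \<subseteq> arcs D" "bd A - {0} = V" by auto
    obtain B where B: "B \<subseteq> arcs D" "bd B = sym_diff {0} {c}"
      using bd_pair[of 0 c] insert.prems by force
    have "bd (sym_diff A B) - {0} = insert c V"
      unfolding bd_sym_diff B(2) using A(2) insert.hyps insert.prems by blast
    moreover have "sym_diff A B \<subseteq> arcs D" using A(1) B(1) by blast
    ultimately show ?case by blast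
  qed
qed

text \<open>Rank-nullity by counting: adding to a cycle a chosen preimage \<open>F V\<close> is
  injective in both arguments. With n crossings there are 2^(n - 1) sets \<open>V\<close> and 2^(2
  n) sets of arcs, which leaves at most 2^(n + 1) cycles.\<close>

lemma card_bd_kernel:
  assumes "crossings D \<noteq> []"
  shows "card {A. A \<subseteq> arcs D \<and> bd A = {}} \<le> 2 ^ (ncross D + 1)" (is "card ?K \<le> _")
proof -
  define F where "F V = (SOME A. A \<subseteq> arcs D \<and> bd A - {0} = V)" for V
  have F: "F V \<subseteq> arcs D \<and> bd (F V) - {0} = V" if "V \<subseteq> {..<ncross D} - {0}" for V
    unfolding F_def using bd_onto[OF that] by (rule someI_ex)
  have "inj_on (\<lambda>(A, V). sym_diff A (F V)) (?K \<times> Pow ({..<ncross D} - {0}))"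
  proof (rule inj_onI, clarsimp)
    fix A V B W
    assume AB: "bd A = {}" "bd B = {}" and VW: "V \<subseteq> {..<ncross D} - {0}" "W \<subseteq> {..<ncross D} - {0}"
      and eq: "sym_diff A (F V) = sym_diff B (F W)"
    have "bd (F V) = bd (F W)"
      using arg_cong[OF eq, of bd] AB unfolding bd_sym_diff by simp
    then have "V = W" using F VW by metis
    with eq show "A = B \<and> V = W" by blast
  qed
  moreover have "(\<lambda>(A, V). sym_diff A (F V)) ` (?K \<times> Pow ({..<ncross D} - {0})) \<subseteq> Pow (arcs D)"
  proof (rule image_subsetI, clarify)
    fix A V a assume "A \<subseteq> arcs D" "V \<subseteq> {..<ncross D} - {0}" "a \<in> sym_diff A (F V)"
    with F[of V] show "a \<in> arcs D" by blast
  qed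
  ultimately have "card (?K \<times> Pow ({..<ncross D} - {0})) \<le> card (Pow (arcs D))"
    using finite_arcs by (intro card_inj_on_le) auto
  moreover have "card ({..<ncross D} - {0}) = ncross D - 1"
    using assms by (simp add: card_Diff_singleton)
  ultimately have "card ?K * 2 ^ (ncross D - 1) \<le> 2 ^ (2 * ncross D)"
    using card_arcs[OF assms] finite_arcs by (simp add: card_cartesian_product card_Pow)
  also have "2 * ncross D = (ncross D + 1) + (ncross D - 1)"
    using assms by (cases "crossings D") auto
  finally show ?thesis by (simp add: power_add)
qed

section \<open>Colourings of the regions and their coboundaries\<close>

definition colourings :: "('a \<times> side) set set" where
  "colourings = {S. S \<subseteq> arcs D \<times> UNIV \<and>
     (\<forall>x\<in>set (crossings D). \<forall>(s, t)\<in>corners x. s \<in> S \<longleftrightarrow> t \<in> S)}"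

definition cobd :: "('a \<times> side) set \<Rightarrow> 'a set" where
  "cobd S = {a \<in> arcs D. ((a, Lft) \<in> S) \<noteq> ((a, Rgt) \<in> S)}"

lemma colourings_corner:
  "S \<in> colourings \<Longrightarrow> x \<in> set (crossings D) \<Longrightarrow> (s, t) \<in> corners x \<Longrightarrow> s \<in> S \<longleftrightarrow> t \<in> S"
  by (auto simp: colourings_def)

lemma finite_UNIV_side: "finite (UNIV :: side set)"
proof -
  have "UNIV = {Lft, Rgt}" using side.exhaust by auto
  then show ?thesis by (metis finite.simps)
qed

lemma finite_sides: "finite (arcs D \<times> (UNIV :: side set))"
  using finite_arcs finite_UNIV_side by simp

lemma finite_colourings: "finite colourings"
  by (rule finite_subset[of _ "Pow (arcs D \<times> UNIV)"])
    (auto simp: colourings_def finite_sides)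

text \<open>Regions are nonempty and disjoint, so different sets of regions have different unions.
  Planarity enters here, through the number of regions.\<close>

lemma card_colourings: "2 ^ (ncross D + 2) \<le> card colourings"
proof -
  let ?r = "\<Union>x\<in>set (crossings D). corners x"
  have r: "?r \<subseteq> (arcs D \<times> UNIV) \<times> (arcs D \<times> UNIV)" using corners_arcs by blast
  have fin: "finite (regions D)"
    unfolding regions_def by (rule finite_classes[OF finite_sides])
  have "inj_on \<Union> (Pow (regions D))"
  proof (rule inj_onI)
    have le: "U \<subseteq> V" if sub: "U \<subseteq> regions D" "V \<subseteq> regions D" "\<Union>U = \<Union>V" for U V
    proof
      fix C assume C: "C \<in> U"
      then have C': "C \<in> classes (arcs D \<times> UNIV) ?r" using sub by (auto simp: regions_def)
      then obtain x where x: "x \<in> C" by (rule classes_nonempty)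
      then obtain B where B: "B \<in> V" "x \<in> B" using C sub(3) by blast
      then have "B \<in> classes (arcs D \<times> UNIV) ?r" using sub by (auto simp: regions_def)
      with classes_unique[OF C' _ x B(2)] B(1) show "C \<in> V" by blast
    qed
    fix U V assume "U \<in> Pow (regions D)" "V \<in> Pow (regions D)" "\<Union>U = \<Union>V"
    with le[of U V] le[of V U] show "U = V" by auto
  qed
  moreover have "\<Union> ` Pow (regions D) \<subseteq> colourings"
  proof (rule image_subsetI)
    fix U assume U: "U \<in> Pow (regions D)"
    have "\<Union>U \<subseteq> arcs D \<times> UNIV"
      using U classes_subset[OF _ r] unfolding regions_def by blast
    moreover have "s \<in> \<Union>U \<longleftrightarrow> t \<in> \<Union>U" if "x \<in> set (crossings D)" "(s, t) \<in> corners x" for x s t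
    proof -
      have "(s, t) \<in> ?r" using that by blast
      then have "s \<in> C \<longleftrightarrow> t \<in> C" if "C \<in> U" for C
        using classes_closed[of C "arcs D \<times> UNIV" ?r s t] that U unfolding regions_def by blast
      then show ?thesis by blast
    qed
    ultimately show "\<Union>U \<in> colourings" unfolding colourings_def by blast
  qed
  ultimately have "card (Pow (regions D)) \<le> card colourings"
    by (rule card_inj_on_le) (rule finite_colourings)
  then show ?thesis using card_regions fin by (simp add: card_Pow)
qed

text \<open>A walk once round a crossing returns to the initial colour, so the colour changes at an
  even number of the four ends.\<close>

lemma bd_cobd:
  assumes "S \<in> colourings"
  shows "bd (cobd S) = {}"
proof -
  have False if c: "c \<in> bd (cobd S)" for c
  proof -
    have x: "cr c \<in> set (crossings D)" using c by (auto simp: bd_def)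
    have "(in_r (cr c), Rgt) \<in> S \<longleftrightarrow> (out_r (cr c), Rgt) \<in> S"
      "(out_r (cr c), Lft) \<in> S \<longleftrightarrow> (out_l (cr c), Rgt) \<in> S"
      "(out_l (cr c), Lft) \<in> S \<longleftrightarrow> (in_l (cr c), Lft) \<in> S"
      "(in_l (cr c), Rgt) \<in> S \<longleftrightarrow> (in_r (cr c), Lft) \<in> S"
      by (rule colourings_corner[OF assms x]; simp add: corners_def)+
    with c end_arcs[OF x] show False unfolding bd_def cobd_def by simp blast
  qed
  then show ?thesis by blast
qed

text \<open>Two colourings with the same coboundary agree on all sides or on none, by connectedness,
  and the colour at \<open>outer D\<close> tells which. Hence each coboundary comes from at most two
  colourings.\<close>

lemma inj_on_cobd: "inj_on (\<lambda>S. (cobd S, outer D \<in> S)) colourings"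
proof (rule inj_onI)
  fix S T assume S: "S \<in> colourings" and T: "T \<in> colourings"
    and eq: "(cobd S, outer D \<in> S) = (cobd T, outer D \<in> T)"
  have "(s \<in> S \<longleftrightarrow> s \<in> T) \<longleftrightarrow> (outer D \<in> S \<longleftrightarrow> outer D \<in> T)" if "fst s \<in> arcs D" for s
  proof (rule sides_connected[where P = "\<lambda>s. s \<in> S \<longleftrightarrow> s \<in> T"])
    show "((a, Lft) \<in> S \<longleftrightarrow> (a, Lft) \<in> T) \<longleftrightarrow> ((a, Rgt) \<in> S \<longleftrightarrow> (a, Rgt) \<in> T)"
      if "a \<in> arcs D" for a
      using eq that unfolding cobd_def by blast
  qed (use colourings_corner[OF S] colourings_corner[OF T] that outer_arc in blast)+
  then have "s \<in> S \<longleftrightarrow> s \<in> T" if "fst s \<in> arcs D" for s using eq that by simp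
  moreover have "S \<subseteq> arcs D \<times> UNIV" "T \<subseteq> arcs D \<times> UNIV"
    using S T by (auto simp: colourings_def)
  ultimately show "S = T" by fastforce
qed

text \<open>
  Over the field with two elements the planar surface has no first homology: by Euler's formula the
  coboundaries of sets of regions are as numerous as the 1-cycles, hence the set of all arcs, which
  is a cycle because the crossings are 4-valent, is a coboundary.
\<close>

lemma checkerboard:
  obtains S where "S \<in> colourings" "cobd S = arcs D"
proof (cases "crossings D = []")
  case True
  let ?S = "arcs D \<times> {Lft}"
  have "?S \<in> colourings" using True by (auto simp: colourings_def)
  moreover have "cobd ?S = arcs D" by (auto simp: cobd_def)
  ultimately show thesis by (rule that)
next
  case False
  let ?K = "{A. A \<subseteq> arcs D \<and> bd A = {}}"
  have finK: "finite ?K" using finite_arcs by simp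
  have sub: "cobd ` colourings \<subseteq> ?K" using bd_cobd by (auto simp: cobd_def)
  have "(\<lambda>S. (cobd S, outer D \<in> S)) ` colourings \<subseteq> cobd ` colourings \<times> UNIV" by auto
  then have "card colourings \<le> card (cobd ` colourings \<times> (UNIV :: bool set))"
    by (intro card_inj_on_le[OF inj_on_cobd]) (simp_all add: finite_colourings)
  then have "2 ^ (ncross D + 1) \<le> card (cobd ` colourings)"
    using card_colourings by (simp add: card_cartesian_product)
  with card_bd_kernel[OF False] have "card ?K \<le> card (cobd ` colourings)" by linarith
  then have "cobd ` colourings = ?K" by (rule card_seteq[OF finK sub])
  moreover have "arcs D \<in> ?K" using end_arcs by (simp add: bd_def)
  ultimately have "arcs D \<in> cobd ` colourings" by simp
  then show thesis using that by (metis imageE)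
qed

section \<open>Parity of paths from the unbounded region\<close>

lemma joined_to_outer_exists:
  assumes "fst s \<in> arcs D"
  shows "\<exists>k. joined_to_outer D s k"
proof -
  define P where "P s \<longleftrightarrow> (\<exists>k. joined_to_outer D s k)" for s
  have "P s \<longleftrightarrow> P (outer D)"
  proof (rule sides_connected)
    fix x s t assume x: "x \<in> set (crossings D)" "(s, t) \<in> corners x"
    show "P s \<longleftrightarrow> P t"
      unfolding P_def by (intro iffI; elim exE; rule exI; erule within[OF _ x(1)]; simp add: x(2))
  next
    have *: "P (a, opposite b)" if "P (a, b)" for a b
      using that across[of D a b] unfolding P_def by blast
    show "P (a, Lft) \<longleftrightarrow> P (a, Rgt)" for a
      using *[of a Lft] *[of a Rgt] by auto
  qed (fact assms outer_arc)+
  moreover have "P (outer D)" unfolding P_def by (rule exI, rule start)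
  ultimately show ?thesis unfolding P_def by simp
qed

text \<open>In a checkerboard colouring a corner keeps the colour and an arc switches it. Hence the
  parity of \<open>k\<close> depends on the side \<open>s\<close> and not on the path.\<close>

lemma joined_to_outer_parity:
  assumes "joined_to_outer D s k" "S \<in> colourings" "cobd S = arcs D"
  shows "fst s \<in> arcs D \<and> ((s \<in> S) \<noteq> (outer D \<in> S) \<longleftrightarrow> odd k)"
  using assms(1)
proof induction
  case (within s k x t)
  have "s \<in> S \<longleftrightarrow> t \<in> S"
    using within(3) colourings_corner[OF assms(2) within(2)] by blast
  moreover have "t \<in> arcs D \<times> UNIV"
    using within(3) corners_arcs[OF within(2)] by blast
  ultimately show ?case using within.IH by (auto simp: mem_Times_iff)
next
  case (across a b k)
  then have "((a, b) \<in> S) \<noteq> ((a, opposite b) \<in> S)"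
    using assms(3) by (cases b) (auto simp: cobd_def)
  with across.IH show ?case by auto
qed (simp add: outer_arc)


section \<open>Circles at a crossing\<close>

lemma oriented_circles:
  "circles D v0 = classes (arcs D) (\<Union>c<ncross D. oriented_smoothing (cr c))"
proof -
  have "(\<Union>c<ncross D. if c \<in> v0 then smoothing1 (cr c) else smoothing0 (cr c)) =
      (\<Union>c<ncross D. oriented_smoothing (cr c))"
    by (intro SUP_cong)
      (auto simp: oriented_resolution_def neg_crossings_def smoothing0_def smoothing1_def)
  then show ?thesis by (simp add: circles_def)
qed

lemma finite_circles: "finite (circles D v)"
  unfolding circles_def by (rule finite_classes[OF finite_arcs])

text \<open>The colour on the left is constant along a circle of the oriented resolution, so the
  parity that defines its label can be read off at any of its arcs.\<close>

lemma odd_circle_iff: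
  assumes S: "S \<in> colourings" "cobd S = arcs D" and C: "C \<in> circles D v0" and a: "a \<in> C"
  shows "odd_circle D C \<longleftrightarrow> ((a, Lft) \<in> S) \<noteq> (outer D \<in> S)"
proof -
  have C': "C \<in> classes (arcs D) (\<Union>c<ncross D. oriented_smoothing (cr c))"
    using C by (simp add: oriented_circles)
  have arc: "b \<in> arcs D" if "b \<in> C" for b
  proof -
    have "(\<Union>c<ncross D. oriented_smoothing (cr c)) \<subseteq> arcs D \<times> arcs D"
      using end_arcs by (auto simp: oriented_smoothing_def)
    from classes_subset[OF C' this] that show ?thesis by blast
  qed
  have const: "((b, Lft) \<in> S) = ((a, Lft) \<in> S)" if "b \<in> C" for b
  proof (rule classes_invariant[OF C' that a])
    fix u v assume "(u, v) \<in> (\<Union>c<ncross D. oriented_smoothing (cr c))"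
    then obtain i where "i < ncross D" "(u, v) \<in> oriented_smoothing (cr i)" by blast
    moreover define x where "x = cr i"
    ultimately have x: "x \<in> set (crossings D)" "(u, v) \<in> oriented_smoothing x" by simp_all
    have "(out_l x, Lft) \<in> S \<longleftrightarrow> (in_l x, Lft) \<in> S" "(in_r x, Rgt) \<in> S \<longleftrightarrow> (out_r x, Rgt) \<in> S"
      by (rule colourings_corner[OF S(1) x(1)]; simp add: corners_def)+
    moreover have "((b, Lft) \<in> S) \<noteq> ((b, Rgt) \<in> S)" if "b \<in> arcs D" for b
      using that S(2) unfolding cobd_def by blast
    ultimately show "(u, Lft) \<in> S \<longleftrightarrow> (v, Lft) \<in> S"
      using x(2) end_arcs[OF x(1)] unfolding oriented_smoothing_def by auto
  qed
  show ?thesis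
  proof
    assume "odd_circle D C"
    then obtain b k where "b \<in> C" "joined_to_outer D (b, Lft) k" "odd k"
      unfolding odd_circle_def by blast
    then show "((a, Lft) \<in> S) \<noteq> (outer D \<in> S)"
      using joined_to_outer_parity[OF _ S] const by blast
  next
    assume *: "((a, Lft) \<in> S) \<noteq> (outer D \<in> S)"
    \<comment> \<open>The existential in \<open>odd_circle\<close> calls for some path; its parity
      is then forced by the colouring.\<close>
    obtain k where k: "joined_to_outer D (a, Lft) k"
      using joined_to_outer_exists[of "(a, Lft)"] arc[OF a] by auto
    with joined_to_outer_parity[OF k S] * a show "odd_circle D C"
      unfolding odd_circle_def by blast
  qed
qed

text \<open>The canonical generator has the label \<open>x + sign C\<close> on the circle
  \<open>C\<close>.\<close>

definition sign :: "'a set \<Rightarrow> complex" where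
  "sign C = (if odd_circle D C then -1 else 1)"

lemma sign_nonzero [simp]: "sign C \<noteq> 0"
  by (simp add: sign_def)

lemma sign_square [simp]: "sign C * sign C = 1"
  by (simp add: sign_def)

text \<open>The south corner lies to the right of \<open>in_l\<close> and to the left of
  \<open>in_r\<close>, so the left sides of these arcs have opposite colours. Opposite labels in
  turn force the circles to be distinct.\<close>

lemma crossing_circles:
  assumes "c < ncross D"
  obtains C1 C2 where "C1 \<in> circles D v0" "C2 \<in> circles D v0"
    "in_l (cr c) \<in> C1" "out_l (cr c) \<in> C1" "in_r (cr c) \<in> C2" "out_r (cr c) \<in> C2"
    "C1 \<noteq> C2" "sign C1 = - sign C2"
proof -
  let ?r = "\<Union>c<ncross D. oriented_smoothing (cr c)"
  have x: "cr c \<in> set (crossings D)" using assms by simp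
  obtain C1 where C1: "C1 \<in> classes (arcs D) ?r" "in_l (cr c) \<in> C1"
    using end_arcs(1)[OF x] by (rule classes_coverE)
  obtain C2 where C2: "C2 \<in> classes (arcs D) ?r" "in_r (cr c) \<in> C2"
    using end_arcs(2)[OF x] by (rule classes_coverE)
  have *: "C1 \<in> circles D v0" "C2 \<in> circles D v0" using C1 C2 by (auto simp: oriented_circles)
  have "(in_l (cr c), out_l (cr c)) \<in> ?r" "(in_r (cr c), out_r (cr c)) \<in> ?r"
    using assms by (auto simp: oriented_smoothing_def)
  then have outs: "out_l (cr c) \<in> C1" "out_r (cr c) \<in> C2"
    using classes_closed[OF C1(1)] classes_closed[OF C2(1)] C1(2) C2(2) by blast+
  obtain S where S: "S \<in> colourings" "cobd S = arcs D" by (rule checkerboard)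
  have "(in_l (cr c), Rgt) \<in> S \<longleftrightarrow> (in_r (cr c), Lft) \<in> S"
    by (rule colourings_corner[OF S(1) x]) (simp add: corners_def)
  moreover have "((in_l (cr c), Lft) \<in> S) \<noteq> ((in_l (cr c), Rgt) \<in> S)"
    using S(2) end_arcs(1)[OF x] unfolding cobd_def by blast
  ultimately have "odd_circle D C1 \<noteq> odd_circle D C2"
    using odd_circle_iff[OF S *(1) C1(2)] odd_circle_iff[OF S *(2) C2(2)] by blast
  then have "sign C1 = - sign C2" "C1 \<noteq> C2" by (auto simp: sign_def)
  with * C1(2) C2(2) outs show thesis by (intro that)
qed

text \<open>
  That the two circles merge into a single one need not be shown: otherwise the coefficients of
  the edge vanish.
\<close>

lemma circles_change:
  assumes c: "c < ncross D" and v: "sym_diff v v0 = {c}"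
    and C1: "C1 \<in> circles D v0" "in_l (cr c) \<in> C1" "out_l (cr c) \<in> C1"
    and C2: "C2 \<in> circles D v0" "in_r (cr c) \<in> C2" "out_r (cr c) \<in> C2"
    and ne: "C1 \<noteq> C2"
  shows "circles D v0 - circles D v = {C1, C2}"
proof -
  let ?r = "\<Union>i\<in>{..<ncross D} - {c}. oriented_smoothing (cr i)"
  let ?s = "oriented_smoothing (cr c)" and ?t = "unoriented_smoothing (cr c)"
  have "(\<Union>i<ncross D. oriented_smoothing (cr i)) = ?r \<union> ?s" using c by blast
  then have cv0: "circles D v0 = classes (arcs D) (?r \<union> ?s)" by (simp add: oriented_circles)
  have "(if i \<in> v then smoothing1 (cr i) else smoothing0 (cr i)) =
      (if i = c then ?t else oriented_smoothing (cr i))"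
    if "i < ncross D" for i
  proof -
    \<comment> \<open>Flipping \<open>c\<close> replaces the oriented by the unoriented smoothing at
      \<open>c\<close> alone, whatever its sign. Edges that leave \<open>v0\<close> and edges that
      enter it are thus treated together.\<close>
    have "i \<in> v \<longleftrightarrow> (i \<in> v0) \<noteq> (i = c)" using v by blast
    with that show ?thesis
      by (auto simp: oriented_resolution_def neg_crossings_def smoothing0_def smoothing1_def)
  qed
  then have "(\<Union>i<ncross D. if i \<in> v then smoothing1 (cr i) else smoothing0 (cr i)) =
      (\<Union>i<ncross D. if i = c then ?t else oriented_smoothing (cr i))"
    by (intro SUP_cong) auto
  also have "\<dots> = ?r \<union> ?t" using c by (auto split: if_splits)
  finally have cv: "circles D v = classes (arcs D) (?r \<union> ?t)" by (simp add: circles_def)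
  have t: "in_l (cr c) \<in> C \<longleftrightarrow> in_r (cr c) \<in> C" if "C \<in> circles D v" for C
    using that classes_closed[of C "arcs D" "?r \<union> ?t" "in_l (cr c)" "in_r (cr c)"]
    unfolding cv by (auto simp: unoriented_smoothing_def)
  \<comment> \<open>The unoriented smoothing puts both incoming arcs on one circle, whereas
    \<open>C1\<close> contains only \<open>in_l\<close> and \<open>C2\<close> only
    \<open>in_r\<close>.\<close>
  have "C \<notin> circles D v" if "C = C1 \<or> C = C2" for C
    using that t C1 C2 ne classes_unique[of C1 "arcs D" "?r \<union> ?s" C2] unfolding cv0 by blast
  moreover have "C \<in> circles D v" if "C \<in> circles D v0" "C \<noteq> C1" "C \<noteq> C2" for C
  proof -
    have "C \<inter> {in_l (cr c), out_l (cr c), in_r (cr c), out_r (cr c)} = {}"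
      using that C1 C2 classes_unique[of C "arcs D" "?r \<union> ?s"] unfolding cv0 by blast
    then show ?thesis
      using that(1) classes_change_off[of C "arcs D" ?r ?s ?t] unfolding cv cv0
      by (auto simp: Field_def oriented_smoothing_def unoriented_smoothing_def)
  qed
  ultimately show ?thesis using C1(1) C2(1) by blast
qed

end


section \<open>Cancellation along the edges\<close>

lemma sum_sign_reversing:
  fixes f :: "'b \<Rightarrow> complex"
  assumes "\<And>x. x \<in> A \<Longrightarrow> t x \<in> A" "\<And>x. x \<in> A \<Longrightarrow> t (t x) = x"
    "\<And>x. x \<in> A \<Longrightarrow> f (t x) = - f x"
  shows "sum f A = 0"
proof -
  have "bij_betw t A A"
    by (rule bij_betw_byWitness[where f' = t]) (use assms in auto)
  then have "sum f A = (\<Sum>x\<in>A. f (t x))" by (rule sum.reindex_bij_betw[symmetric])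
  also have "\<dots> = - sum f A" using assms(3) by (simp add: sum_negf)
  finally show ?thesis by simp
qed

lemma sym_diff_sym_diff: "sym_diff (sym_diff X P) P = X"
  by blast

lemma card_sym_diff_pair:
  assumes "C1 \<noteq> C2"
  shows "card (sym_diff X {C1, C2} \<inter> {C1, C2}) = 2 - card (X \<inter> {C1, C2})"
proof -
  have "sym_diff X {C1, C2} \<inter> {C1, C2} = {C1, C2} - X \<inter> {C1, C2}" by blast
  then show ?thesis using assms by (simp add: card_Diff_subset)
qed

lemma even_card_sym_diff:
  assumes "finite A" "finite B"
  shows "even (card (sym_diff A B)) \<longleftrightarrow> even (card A + card B)"
proof -
  have "card (sym_diff A B) = card (A - B) + card (B - A)"
    using assms by (intro card_Un_disjoint) auto
  moreover have "card A = card (A - B) + card (A \<inter> B)"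
    using assms by (metis card_Diff_subset_Int card_mono finite_Int inf_le1 le_add_diff_inverse2)
  moreover have "card B = card (B - A) + card (A \<inter> B)"
    using assms by (metis Int_commute card_Diff_subset_Int card_mono finite_Int inf_le2 le_add_diff_inverse2)
  ultimately show ?thesis by presburger
qed

text \<open>The part of \<open>X\<close> in the pair is traded for its complement there. The values
  on the pair are 1 and -1, so the two parts have products with opposite signs.\<close>

lemma prod_sym_diff_pair:
  fixes s :: "'b \<Rightarrow> complex"
  assumes "finite X" "C1 \<noteq> C2" "s C1 = - s C2" "s C1 * s C1 = 1"
  shows "prod s (sym_diff X {C1, C2}) = - prod s X"
proof -
  let ?Z = "X - {C1, C2}"
  have f: "finite ?Z" using assms(1) by simp
  have X: "prod s X = prod s ?Z * prod s (X \<inter> {C1, C2})"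
    using prod.Int_Diff[OF assms(1), of s "{C1, C2}"] by (simp add: mult.commute)
  have "sym_diff X {C1, C2} = ?Z \<union> ({C1, C2} - X)" by blast
  then have Y: "prod s (sym_diff X {C1, C2}) = prod s ?Z * prod s ({C1, C2} - X)"
    using f by (metis (no_types, lifting) Diff_disjoint Int_Diff Int_commute finite.emptyI finite.insertI finite_Diff prod.union_disjoint Diff_Int_distrib2)
  have "s C2 * s C2 = 1" "s C1 * s C2 = -1" "s C2 * s C1 = -1"
    using assms(3,4) by (simp_all add: minus_equation_iff)
  moreover have "X \<inter> {C1, C2} = (if C1 \<in> X then {C1} else {}) \<union> (if C2 \<in> X then {C2} else {})"
    "{C1, C2} - X = (if C1 \<in> X then {} else {C1}) \<union> (if C2 \<in> X then {} else {C2})"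
    by auto
  ultimately have "prod s ({C1, C2} - X) = - prod s (X \<inter> {C1, C2})"
    using assms(2,3) by (cases "C1 \<in> X"; cases "C2 \<in> X") simp_all
  then show ?thesis unfolding X Y by simp
qed

text \<open>Exchanging 1 and \<open>x\<close> in both factors is multiplication by \<open>x\<close>
  in each, and \<open>x * x = 1\<close>. For the same reason the comultiplication is symmetric under
  this exchange in its two output factors.\<close>

lemma mult_coeff_flip: "p \<le> 2 \<Longrightarrow> mult_coeff (2 - p) q = mult_coeff p q"
  by (auto simp: mult_coeff_def)

lemma comult_coeff_flip: "q \<le> 2 \<Longrightarrow> comult_coeff p (2 - q) = comult_coeff p q"
  by (auto simp: comult_coeff_def)

lemma card_Int_pair_le: "card (X \<inter> {C1, C2}) \<le> 2"
proof -
  have "card (X \<inter> {C1, C2}) \<le> card {C1, C2}" by (rule card_mono) auto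
  also have "\<dots> \<le> 2" by (simp add: card_insert_if)
  finally show ?thesis .
qed

lemma edge_coeff_flip_source:
  assumes "circles D v - circles D w = {C1, C2}" "C1 \<noteq> C2"
  shows "edge_coeff D (v, sym_diff X {C1, C2}) (w, Y) = edge_coeff D (v, X) (w, Y)"
proof -
  have "sym_diff X {C1, C2} - {C1, C2} = X - {C1, C2}" by blast
  then show ?thesis
    unfolding edge_coeff_def Let_def prod.case assms(1) card_sym_diff_pair[OF assms(2)]
    using assms(2) by (simp add: mult_coeff_flip card_Int_pair_le)
qed

lemma edge_coeff_flip_target:
  assumes "circles D w - circles D v = {C1, C2}" "C1 \<noteq> C2"
  shows "edge_coeff D (v, X) (w, sym_diff Y {C1, C2}) = edge_coeff D (v, X) (w, Y)"
proof -
  have "sym_diff Y {C1, C2} - {C1, C2} = Y - {C1, C2}" by blast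
  then show ?thesis
    unfolding edge_coeff_def Let_def prod.case assms(1) card_sym_diff_pair[OF assms(2)]
    using assms(2) by (simp add: comult_coeff_flip card_Int_pair_le)
qed


section \<open>The canonical generator and the detecting functional\<close>

context knot
begin

section \<open>The canonical generator is a cycle\<close>

lemma v0_subset: "v0 \<subseteq> {..<ncross D}"
  by (auto simp: oriented_resolution_def neg_crossings_def)

lemma canonical_generator_v0:
  "X \<subseteq> circles D v0 \<Longrightarrow> canonical_generator D (v0, X) = prod sign (circles D v0 - X)"
  by (simp add: canonical_generator_def sign_def)

lemma canonical_generator_chain: "canonical_generator D \<in> chains D 0"
  using v0_subset
  by (auto simp: chains_def canonical_generator_def enhanced_states_def oriented_resolution_def)

text \<open>This is \<open>(x + 1) * (x - 1) = 0\<close> on the two circles at a crossing.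
  Exchanging 1 and \<open>x\<close> on both circles keeps the edge coefficient and reverses the
  coefficient of the generator, so the terms cancel.\<close>

lemma canonical_generator_cycle: "canonical_generator D \<in> cycles D 0"
proof -
  have "(\<Sum>X\<in>Pow (circles D (w - {c})). (-1) ^ card {b \<in> w. b < c} *
      edge_coeff D (w - {c}, X) (w, Y) * canonical_generator D (w - {c}, X)) = 0"
    if w: "w \<subseteq> {..<ncross D}" and c: "c \<in> w" for w Y c
  proof (cases "w - {c} = v0")
    case False
    then show ?thesis by (simp add: canonical_generator_def)
  next
    case True
    have c': "c < ncross D" using w c by auto
    obtain C1 C2 where C: "C1 \<in> circles D v0" "C2 \<in> circles D v0"
      "in_l (cr c) \<in> C1" "out_l (cr c) \<in> C1" "in_r (cr c) \<in> C2" "out_r (cr c) \<in> C2"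
      "C1 \<noteq> C2" "sign C1 = - sign C2" using c' by (rule crossing_circles)
    have "sym_diff w v0 = {c}" using True c by blast
    then have old: "circles D v0 - circles D w = {C1, C2}"
      using circles_change[OF c'] C by blast
    let ?f = "\<lambda>X. (-1) ^ card {b \<in> w. b < c} * edge_coeff D (v0, X) (w, Y) * canonical_generator D (v0, X)"
    have "sum ?f (Pow (circles D v0)) = 0"
    proof (rule sum_sign_reversing[where t = "\<lambda>X. sym_diff X {C1, C2}"])
      fix X assume X: "X \<in> Pow (circles D v0)"
      then show X': "sym_diff X {C1, C2} \<in> Pow (circles D v0)" using C by blast
      show "sym_diff (sym_diff X {C1, C2}) {C1, C2} = X" by (rule sym_diff_sym_diff)
      \<comment> \<open>The coefficient is a product over the circles with factor 1, that is,
        outside \<open>X\<close>; the exchange acts on this complement in the same way.\<close>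
      have "circles D v0 - sym_diff X {C1, C2} = sym_diff (circles D v0 - X) {C1, C2}"
        using X C by blast
      then have "canonical_generator D (v0, sym_diff X {C1, C2}) = - canonical_generator D (v0, X)"
        using X X' C finite_circles by (simp add: canonical_generator_v0 prod_sym_diff_pair del: Un_Diff_cancel)
      then show "?f (sym_diff X {C1, C2}) = - ?f X"
        by (simp only: edge_coeff_flip_source[OF old C(7)] mult_minus_right)
    qed
    with True show ?thesis by simp
  qed
  then have "lee_d D (canonical_generator D) (w, Y) = 0" for w Y
    unfolding lee_d_def by (auto simp: enhanced_states_def intro!: sum.neutral)
  then have "lee_d D (canonical_generator D) = (\<lambda>_. 0)" by auto
  then show ?thesis using canonical_generator_chain by (simp add: cycles_def)
qed

section \<open>The functional that detects the canonical class\<close>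

abbreviation comps :: "'a set set set" where
  "comps \<equiv> components (minus_subgraph (seifert_graph D))"

definition minus_rel :: "'a set rel" where
  "minus_rel = {(A, B). \<exists>c\<in>v0. {C \<in> circles D v0. in_l (cr c) \<in> C \<or> in_r (cr c) \<in> C} = {A, B}}"

lemma comps_eq: "comps = classes (circles D v0) minus_rel"
proof -
  have "{e \<in> {..<ncross D}. \<not> positive (cr e)} = v0"
    by (auto simp: oriented_resolution_def neg_crossings_def)
  then show ?thesis
    by (simp add: components_def minus_subgraph_def seifert_graph_def minus_rel_def)
qed

lemma minus_rel_subset: "minus_rel \<subseteq> circles D v0 \<times> circles D v0"
  unfolding minus_rel_def by blast

text \<open>
  Modulo the images of the edges into the oriented resolution one may replace \<open>x\<close> on a circle by
  \<open>- x\<close> on a neighbouring circle of \<open>T\<^sup>-(D)\<close>; thus a basis tensor only depends, up to sign, on the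
  parity of the number of factors \<open>x\<close> in each component.
\<close>

definition odd_states :: "'a set set set" where
  "odd_states = {X. X \<subseteq> circles D v0 \<and> (\<forall>K\<in>comps. odd (card (X \<inter> K)))}"

text \<open>The weight changes sign when 1 and \<open>x\<close> are exchanged on two circles with
  opposite labels, which makes the functional vanish on boundaries.\<close>

definition detect :: "'a chain \<Rightarrow> complex" where
  "detect f = (\<Sum>X\<in>odd_states. prod sign X * f (v0, X))"

lemma finite_odd_states: "finite odd_states"
  by (rule finite_subset[of _ "Pow (circles D v0)"]) (auto simp: odd_states_def finite_circles)

text \<open>An edge into \<open>v0\<close> belongs to a negative crossing. The exchange on its two
  circles preserves the odd states and the edge coefficient and reverses the weight, so each edge
  contributes zero.\<close>

lemma detect_lee_d: "detect (lee_d D g) = 0"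
proof -
  have edge: "(\<Sum>Y\<in>odd_states. prod sign Y * edge_coeff D (v0 - {c}, X) (v0, Y)) = 0"
    if c: "c \<in> v0" for c X
  proof -
    have c': "c < ncross D" using c v0_subset by auto
    obtain C1 C2 where C: "C1 \<in> circles D v0" "C2 \<in> circles D v0"
      "in_l (cr c) \<in> C1" "out_l (cr c) \<in> C1" "in_r (cr c) \<in> C2" "out_r (cr c) \<in> C2"
      "C1 \<noteq> C2" "sign C1 = - sign C2" using c' by (rule crossing_circles)
    have "sym_diff (v0 - {c}) v0 = {c}" using c by blast
    then have new: "circles D v0 - circles D (v0 - {c}) = {C1, C2}"
      using circles_change[OF c'] C by blast
    have "{C \<in> circles D v0. in_l (cr c) \<in> C \<or> in_r (cr c) \<in> C} = {C1, C2}"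
      using C classes_unique[of _ "arcs D" "\<Union>c<ncross D. oriented_smoothing (cr c)"]
      unfolding oriented_circles by blast
    then have rel: "(C1, C2) \<in> minus_rel" using c unfolding minus_rel_def by blast
    show ?thesis
    proof (rule sum_sign_reversing[where t = "\<lambda>Y. sym_diff Y {C1, C2}"])
      fix Y assume Y: "Y \<in> odd_states"
      then have fin: "finite Y"
        using finite_circles finite_subset unfolding odd_states_def by blast
      have "odd (card (sym_diff Y {C1, C2} \<inter> K))" if K: "K \<in> comps" for K
      proof -
        \<comment> \<open>The circles are adjacent in the minus subgraph and lie in one component,
          so the parity in every component survives.\<close>
        have "C1 \<in> K \<longleftrightarrow> C2 \<in> K"
          using classes_closed[OF _ rel] K unfolding comps_eq by blast
        then have e: "even (card ({C1, C2} \<inter> K))" using C(7) by (cases "C1 \<in> K") auto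
        have "sym_diff Y {C1, C2} \<inter> K = sym_diff (Y \<inter> K) ({C1, C2} \<inter> K)" by blast
        moreover have "odd (card (Y \<inter> K))" using Y K unfolding odd_states_def by blast
        ultimately show ?thesis
          using e fin even_card_sym_diff[of "Y \<inter> K" "{C1, C2} \<inter> K"] by simp
      qed
      then show "sym_diff Y {C1, C2} \<in> odd_states"
        using Y C unfolding odd_states_def by blast
      show "sym_diff (sym_diff Y {C1, C2}) {C1, C2} = Y" by (rule sym_diff_sym_diff)
      show "prod sign (sym_diff Y {C1, C2}) * edge_coeff D (v0 - {c}, X) (v0, sym_diff Y {C1, C2}) =
          - (prod sign Y * edge_coeff D (v0 - {c}, X) (v0, Y))"
        unfolding edge_coeff_flip_target[OF new C(7)]
        using prod_sym_diff_pair[OF fin C(7,8)] by simp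
    qed
  qed
  have "detect (lee_d D g) = (\<Sum>Y\<in>odd_states. \<Sum>c\<in>v0. \<Sum>X\<in>Pow (circles D (v0 - {c})).
      ((-1) ^ card {b \<in> v0. b < c} * g (v0 - {c}, X)) *
      (prod sign Y * edge_coeff D (v0 - {c}, X) (v0, Y)))"
    unfolding detect_def lee_d_def
    using v0_subset
    by (intro sum.cong) (auto simp: enhanced_states_def odd_states_def sum_distrib_left mult_ac)
  \<comment> \<open>With the odd states innermost, the sum splits into the vanishing sums of
    \<open>edge\<close>.\<close>
  also have "\<dots> = (\<Sum>c\<in>v0. \<Sum>X\<in>Pow (circles D (v0 - {c})). \<Sum>Y\<in>odd_states.
      ((-1) ^ card {b \<in> v0. b < c} * g (v0 - {c}, X)) *
      (prod sign Y * edge_coeff D (v0 - {c}, X) (v0, Y)))"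
    by (subst sum.swap) (intro sum.cong refl sum.swap)
  also have "\<dots> = 0"
    by (rule sum.neutral, rule ballI, rule sum.neutral, rule ballI)
      (simp only: sum_distrib_left[symmetric] edge mult_zero_right)
  finally show ?thesis .
qed

text \<open>The weight is the product of the signs over \<open>X\<close> and the coefficient the
  product over the other circles, so all odd states contribute the same nonzero term and nothing
  cancels.\<close>

lemma detect_canonical_generator: "detect (canonical_generator D) \<noteq> 0"
proof -
  have "prod sign X * canonical_generator D (v0, X) = prod sign (circles D v0)"
    if "X \<in> odd_states" for X
  proof -
    have X: "X \<subseteq> circles D v0" using that by (simp add: odd_states_def)
    then show ?thesis
      using prod.subset_diff[OF X finite_circles, of sign]
      by (simp add: canonical_generator_v0 mult.commute)
  qed
  then have "detect (canonical_generator D) = of_nat (card odd_states) * prod sign (circles D v0)"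
    by (simp add: detect_def)
  moreover obtain X where "X \<subseteq> circles D v0" "\<And>K. K \<in> comps \<Longrightarrow> card (X \<inter> K) = 1"
    using classes_transversal[OF minus_rel_subset] unfolding comps_eq by blast
  then have "X \<in> odd_states" by (simp add: odd_states_def)
  then have "card odd_states \<noteq> 0" using finite_odd_states by auto
  moreover have "prod sign (circles D v0) \<noteq> 0" using finite_circles by simp
  ultimately show ?thesis by simp
qed

section \<open>Quantum degrees and the bound\<close>

lemma qdeg_odd_state:
  assumes "X \<in> odd_states"
  shows "qdeg D (v0, X) \<le> U_bound D - 1"
proof -
  have X: "X \<subseteq> circles D v0" using assms by (simp add: odd_states_def)
  then have fin: "finite X" using finite_circles finite_subset by blast
  have "X \<inter> K \<noteq> {}" if "K \<in> comps" for K
    using assms that unfolding odd_states_def by force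
  then have "card comps \<le> card X"
    using card_classes_le[OF fin] unfolding comps_eq by blast
  moreover have "card (circles D v0 - X) + card X = card (circles D v0)"
    using X fin finite_circles by (simp add: card_Diff_subset card_mono)
  \<comment> \<open>Exactly the negative crossings are 1-smoothed at \<open>v0\<close>, so the
    degree shift in \<open>qdeg\<close> is the writhe. The 1 subtracted from \<open>U_bound\<close>
    is the one that turns \<open>s_min\<close> into \<open>rasmussen_s\<close>.\<close>
  ultimately show ?thesis
    by (simp add: U_bound_def writhe_def seifert_graph_def oriented_resolution_def)
qed

text \<open>A representative \<open>z\<close> differs from the canonical generator by a boundary, so
  \<open>detect\<close> does not vanish on it. Some odd state therefore occurs in \<open>z\<close>,
  and its quantum degree caps the filtration level.\<close>

lemma filtration_bound:
  assumes "homology_class D 0 (canonical_generator D) \<in> filtered_homology D j 0"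
  shows "j \<le> U_bound D - 1"
proof -
  obtain z where z: "z \<in> filtered_chains D j 0"
    "homology_class D 0 (canonical_generator D) = homology_class D 0 z"
    using assms unfolding filtered_homology_def by blast
  have "lee_d D (\<lambda>_. 0) = (\<lambda>_. 0)" by (auto simp: lee_d_def)
  then have "canonical_generator D \<in> homology_class D 0 (canonical_generator D)"
    unfolding homology_class_def chains_def by force
  then have "canonical_generator D \<in> homology_class D 0 z" by (simp only: z(2))
  then obtain g where "canonical_generator D = (\<lambda>e. z e + lee_d D g e)"
    unfolding homology_class_def by blast
  then have "detect (canonical_generator D) = detect z + detect (lee_d D g)"
    by (simp add: detect_def distrib_left sum.distrib)
  then have "detect z \<noteq> 0"
    using detect_canonical_generator detect_lee_d by simp
  then obtain X where X: "X \<in> odd_states" "z (v0, X) \<noteq> 0"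
    unfolding detect_def by (metis (no_types, lifting) mult_zero_right sum.neutral)
  then have "j \<le> qdeg D (v0, X)" using z(1) unfolding filtered_chains_def by blast
  with qdeg_odd_state[OF X(1)] show ?thesis by linarith
qed

text \<open>The smallest quantum degree over \<open>v0\<close> is an admissible level. Together with
  the upper bound this gives \<open>GREATEST\<close> an actual value.\<close>

lemma filtration_nonempty:
  "\<exists>j. homology_class D 0 (canonical_generator D) \<in> filtered_homology D j 0"
proof -
  define Q where "Q = (\<lambda>X. qdeg D (v0, X)) ` Pow (circles D v0)"
  have Q: "finite Q" unfolding Q_def using finite_circles by simp
  have "Min Q \<le> qdeg D e" if "canonical_generator D e \<noteq> 0" for e
  proof -
    obtain v X where "e = (v, X)" by (cases e)
    with that have "qdeg D e \<in> Q"
      by (auto simp: canonical_generator_def Q_def split: if_splits)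
    with Q show ?thesis by simp
  qed
  then have "canonical_generator D \<in> filtered_chains D (Min Q) 0"
    using canonical_generator_chain by (simp add: filtered_chains_def del: split_paired_All)
  then show ?thesis
    using canonical_generator_cycle unfolding filtered_homology_def by blast
qed

lemma s_min_bound: "s_min D \<le> U_bound D - 1"
proof -
  let ?P = "\<lambda>j. homology_class D 0 (canonical_generator D) \<in> filtered_homology D j 0"
  obtain j0 where j0: "?P j0" using filtration_nonempty by blast
  \<comment> \<open>Cutting off below an admissible \<open>j0\<close> leaves a finite set of levels
    with the same maximum.\<close>
  let ?J = "{j. ?P j \<and> j0 \<le> j}"
  have "?J \<subseteq> {j0..U_bound D - 1}" using filtration_bound by auto
  then have fin: "finite ?J" using finite_subset by blast
  have "Max ?J \<in> ?J" using fin j0 by (intro Max_in) auto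
  moreover have "j \<le> Max ?J" if "?P j" for j
  proof (cases "j0 \<le> j")
    case True
    then show ?thesis using fin that by (intro Max_ge) auto
  next
    case False
    then show ?thesis using \<open>Max ?J \<in> ?J\<close> by simp
  qed
  ultimately have "s_min D = Max ?J"
    unfolding s_min_def by (intro Greatest_equality) auto
  with \<open>Max ?J \<in> ?J\<close> show ?thesis using filtration_bound by simp
qed

end

theorem theorem1p2:
  fixes D :: "'a diagram"
  assumes "knot_diagram D"
  shows "rasmussen_s D \<le> U_bound D"
proof -
  interpret knot D using assms by (rule knot.intro)
  show ?thesis using s_min_bound by (simp add: rasmussen_s_def)
qed

end
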